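(* Let $g_1,\dots,g_m\in\mathbb{R}[\mathbf{x}]$ be concave, $\mathbf{K}=\{\mathbf{x}\in\mathbb{R}^n:g_j(\mathbf{x})\ge0,\ j=1,\dots,m\}$ with $0\in\mathbf{K}$, and $J(0)=\{j\in\{1,\dots,m\}:g_j(0)=0\}$. Let $f\in\mathbb{R}[\mathbf{x}]$ and $k\in\{1,2,\infty\}$. Then the problem $$\rho^k:=\min_{\tilde{\mathbf{A}},\tilde{\mathbf{b}},\lambda}\Big\{\|f-\tilde f\|_k:\ \tilde{\mathbf{b}}=\sum_{j\in J(0)}\lambda_j\nabla g_j(0);\ \tilde{\mathbf{A}}\succeq0;\ \lambda_j\ge0,\ j\in J(0)\Big\},$$ where $\tilde f(\mathbf{x})=\tfrac12\mathbf{x}^T\tilde{\mathbf{A}}\mathbf{x}+\tilde{\mathbf{b}}^T\mathbf{x}+f(0)$ with $\tilde{\mathbf{A}}\in\mathbb{R}^{n\times n}$ symmetric and $\tilde{\mathbf{b}}\in\mathbb{R}^n$, has an optimal solution $\tilde f^*\in\mathbb{R}[\mathbf{x}]_2$, and $0$ is an optimal solution of the convex optimization problem $\min\{\tilde f^*(\mathbf{x}):\mathbf{x}\in\mathbf{K}\}$.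
   Context: $\mathbb{R}[\mathbf{x}]$ denotes real polynomials in $\mathbf{x}=(x_1,\dots,x_n)$, $\mathbb{R}[\mathbf{x}]_2$ those of degree at most $2$. For $h=\sum_\alpha h_\alpha\mathbf{x}^\alpha$: $\|h\|_1=\sum_\alpha|h_\alpha|$, $\|h\|_2=\sum_\alpha h_\alpha^2$ (no square root), $\|h\|_\infty=\max_\alpha|h_\alpha|$. $\tilde{\mathbf{A}}\succeq0$ means positive semidefinite. The given feasible point of the inverse problem is $\mathbf{y}=0\in\mathbf{K}$. *)

theory Defs
  imports "HOL-Analysis.Analysis" "HOL-Library.Poly_Mapping" "HOL-Library.Extended_Nat"
begin

text \<open>
  Real polynomials in variables indexed by the finite type \<open>'n\<close>: finitely supported maps from
  exponent vectors to coefficients, with the ring structure (convolution product) of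
  \<open>HOL-Library.Poly_Mapping\<close>.
\<close>

type_synonym 'n rpoly = "('n \<Rightarrow>\<^sub>0 nat) \<Rightarrow>\<^sub>0 real"

abbreviation coef :: "'n rpoly \<Rightarrow> ('n \<Rightarrow>\<^sub>0 nat) \<Rightarrow> real" where
  "coef \<equiv> Poly_Mapping.lookup"

definition peval :: "('n::finite) rpoly \<Rightarrow> real ^ 'n \<Rightarrow> real" where
  "peval p x =
     (\<Sum>\<alpha>\<in>Poly_Mapping.keys p. coef p \<alpha> * (\<Prod>i\<in>UNIV. (x $ i) ^ Poly_Mapping.lookup \<alpha> i))"

definition polys_deg_le :: "nat \<Rightarrow> ('n::finite) rpoly set" where
  "polys_deg_le d =
     {p. \<forall>\<alpha>\<in>Poly_Mapping.keys p. (\<Sum>i\<in>UNIV. Poly_Mapping.lookup \<alpha> i) \<le> d}"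

definition pconst :: "real \<Rightarrow> 'n rpoly" where
  "pconst c = Poly_Mapping.single 0 c"

definition pvar :: "'n \<Rightarrow> 'n rpoly" where
  "pvar i = Poly_Mapping.single (Poly_Mapping.single i 1) 1"

text \<open>
  The ``norms'' of the coefficient vector. For \<open>k = 2\<close> this is the sum of squares, without
  a square root. Only \<open>k = 1, 2, \<infinity>\<close> are meaningful; every other \<open>k\<close> falls into the last case.
  The element 0 inserted under \<open>Max\<close> matters only for the zero polynomial, which has no keys.
\<close>

definition coef_norm :: "enat \<Rightarrow> 'n rpoly \<Rightarrow> real" where
  "coef_norm k h =
     (if k = 1 then (\<Sum>\<alpha>\<in>Poly_Mapping.keys h. \<bar>coef h \<alpha>\<bar>)
      else if k = 2 then (\<Sum>\<alpha>\<in>Poly_Mapping.keys h. (coef h \<alpha>)\<^sup>2)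
      else Max (insert 0 ((\<lambda>\<alpha>. \<bar>coef h \<alpha>\<bar>) ` Poly_Mapping.keys h)))"

definition gradient :: "('a::real_inner \<Rightarrow> real) \<Rightarrow> 'a \<Rightarrow> 'a" where
  "gradient F x = (THE D. GDERIV F x :> D)"

definition psd :: "real ^ ('n::finite) ^ 'n \<Rightarrow> bool" where
  "psd A \<longleftrightarrow> transpose A = A \<and> (\<forall>x. 0 \<le> x \<bullet> (A *v x))"

definition feasible_region :: "(nat \<Rightarrow> ('n::finite) rpoly) \<Rightarrow> nat \<Rightarrow> (real ^ 'n) set" where
  "feasible_region g m = {x. \<forall>j\<in>{1..m}. 0 \<le> peval (g j) x}"

definition active_set :: "(nat \<Rightarrow> ('n::finite) rpoly) \<Rightarrow> nat \<Rightarrow> real ^ 'n \<Rightarrow> nat set" where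
  "active_set g m y = {j \<in> {1..m}. peval (g j) y = 0}"

text \<open>The polynomial \<open>x\<^sup>T A x / 2 + b\<^sup>T x + c\<close>.\<close>

definition quad_poly :: "real ^ ('n::finite) ^ 'n \<Rightarrow> real ^ 'n \<Rightarrow> real \<Rightarrow> 'n rpoly" where
  "quad_poly A b c =
     pconst (1/2) * (\<Sum>i\<in>UNIV. \<Sum>j\<in>UNIV. pconst (A $ i $ j) * pvar i * pvar j)
       + (\<Sum>i\<in>UNIV. pconst (b $ i) * pvar i) + pconst c"

text \<open>
  The decision variables of the inverse problem are triples \<open>(A, b, lam)\<close>. The multipliers
  are a function on all of \<open>nat\<close>, but only the values on the active set at 0 enter the constraints.
\<close>

definition inv_feasible ::
  "(nat \<Rightarrow> ('n::finite) rpoly) \<Rightarrow> nat \<Rightarrow> (real ^ 'n ^ 'n) \<times> (real ^ 'n) \<times> (nat \<Rightarrow> real) \<Rightarrow> bool" where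
  "inv_feasible g m = (\<lambda>(A, b, lam).
     b = (\<Sum>j\<in>active_set g m 0. lam j *\<^sub>R gradient (peval (g j)) 0) \<and>
     psd A \<and> (\<forall>j\<in>active_set g m 0. 0 \<le> lam j))"

definition inv_objective ::
  "('n::finite) rpoly \<Rightarrow> enat \<Rightarrow> (real ^ 'n ^ 'n) \<times> (real ^ 'n) \<times> (nat \<Rightarrow> real) \<Rightarrow> real" where
  "inv_objective f k = (\<lambda>(A, b, lam). coef_norm k (f - quad_poly A b (peval f 0)))"

definition inv_optimal :: "(nat \<Rightarrow> ('n::finite) rpoly) \<Rightarrow> nat \<Rightarrow> 'n rpoly \<Rightarrow> enat \<Rightarrow> 'n rpoly \<Rightarrow> bool" where
  "inv_optimal g m f k q \<longleftrightarrow>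
     (\<exists>A b lam. is_arg_min (inv_objective f k) (inv_feasible g m) (A, b, lam) \<and>
        q = quad_poly A b (peval f 0))"

end

theory Submission
  imports Defs
begin

text \<open>
  Existence of a minimizer. The multipliers enter the inverse problem only through the vector
  \<open>b\<close>, so one minimizes over pairs \<open>(A, b)\<close> with \<open>A\<close> positive semidefinite and \<open>b\<close> in the convex
  cone generated by the gradients of the active constraints. Both sets are closed; for the second
  this is a genuine theorem about finitely generated cones (\<open>closed_convex_cone_hull\<close>). The
  objective depends continuously on \<open>(A, b)\<close> (\<open>continuous_on_coef_norm\<close>), and it is coercive on the
  feasible set (\<open>bounded_coef_norm_sublevel\<close>): each coefficient of \<open>f - quad_poly A b c\<close> is
  controlled by its \<open>coef_norm\<close>, the linear coefficients of \<open>quad_poly A b c\<close> are the entries of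
  \<open>b\<close>, the coefficients of the pure squares are half the diagonal of \<open>A\<close>, and the diagonal of a
  positive semidefinite matrix dominates all its entries. A continuous coercive function attains
  its infimum on a nonempty closed set, whence \<open>inv_optimal_exists\<close>.

  Optimality of the origin (\<open>inv_feasible_imp_zero_arg_min\<close>). Minimizing \<open>q = quad_poly A b c\<close> over
  the feasible region is a convex problem, and the constraints of the inverse problem are its
  Karush-Kuhn-Tucker conditions at \<open>0\<close>, which are sufficient. Concretely, a concave function lies
  below its tangent (\<open>concave_on_le_tangent\<close>), so \<open>0 \<le> g\<^sub>j x \<le> \<nabla>g\<^sub>j 0 \<bullet> x\<close> for every active \<open>j\<close> and
  feasible \<open>x\<close>. Hence \<open>b \<bullet> x \<ge> 0\<close> and \<open>q x - q 0 = x \<bullet> A x / 2 + b \<bullet> x \<ge> 0\<close>.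
\<close>

section \<open>Evaluation and coefficient norms\<close>

text \<open>
  The set of keys of a polynomial jumps when a coefficient becomes zero. Summing over a fixed
  finite set of exponents instead makes evaluation visibly linear, and, in
  \<open>coef_norm_eq_superset\<close> below, the norms visibly continuous in the coefficients.
\<close>

lemma peval_eq_sum_superset:
  assumes "finite D" "Poly_Mapping.keys p \<subseteq> D"
  shows "peval p x = (\<Sum>\<alpha>\<in>D. coef p \<alpha> * (\<Prod>i\<in>UNIV. (x $ i) ^ Poly_Mapping.lookup \<alpha> i))"
  unfolding peval_def
  by (rule sum.mono_neutral_left) (use assms in \<open>auto simp: in_keys_iff\<close>)

lemma peval_single:
  "peval (Poly_Mapping.single \<alpha> c) x = c * (\<Prod>i\<in>UNIV. (x $ i) ^ Poly_Mapping.lookup \<alpha> i)"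
  by (simp add: peval_eq_sum_superset[of "{\<alpha>}"])

lemma peval_add: "peval (p + q) x = peval p x + peval q x"
proof -
  let ?D = "Poly_Mapping.keys p \<union> Poly_Mapping.keys q"
  have "Poly_Mapping.keys (p + q) \<subseteq> ?D"
    by (rule keys_add)
  then show ?thesis
    by (simp add: peval_eq_sum_superset[of ?D] lookup_add distrib_right sum.distrib)
qed

lemma peval_sum: "peval (\<Sum>i\<in>I. p i) x = (\<Sum>i\<in>I. peval (p i) x)"
proof -
  have "peval 0 x = 0"
    by (simp add: peval_def)
  then show ?thesis
    by (induction I rule: infinite_finite_induct) (simp_all add: peval_add)
qed

lemma differentiable_peval: "peval p differentiable (at x)"
proof -
  have "(\<lambda>x. \<Prod>i\<in>S. (x $ i) ^ Poly_Mapping.lookup \<alpha> i) differentiable (at x)"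
    if "finite S" for S and \<alpha> :: "'a \<Rightarrow>\<^sub>0 nat"
    using that
  proof (induction S)
    case (insert i S)
    have "(\<lambda>x. (x $ i) ^ Poly_Mapping.lookup \<alpha> i) differentiable (at x)"
      by (intro differentiable_power bounded_linear_imp_differentiable bounded_linear_vec_nth)
    then show ?case
      using insert by (simp add: differentiable_mult)
  qed simp
  then show ?thesis
    unfolding peval_def by (intro differentiable_sum differentiable_mult) auto
qed

lemma coef_norm_eq_superset:
  assumes "finite D" "Poly_Mapping.keys h \<subseteq> D"
  shows "coef_norm k h =
    (if k = 1 then (\<Sum>\<alpha>\<in>D. \<bar>coef h \<alpha>\<bar>)
     else if k = 2 then (\<Sum>\<alpha>\<in>D. (coef h \<alpha>)\<^sup>2)
     else Max (insert 0 ((\<lambda>\<alpha>. \<bar>coef h \<alpha>\<bar>) ` D)))"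
proof -
  have Max_set: "insert 0 ((\<lambda>\<alpha>. \<bar>coef h \<alpha>\<bar>) ` Poly_Mapping.keys h) = insert 0 ((\<lambda>\<alpha>. \<bar>coef h \<alpha>\<bar>) ` D)"
    using assms(2) by (force simp: in_keys_iff)
  have sums: "(\<Sum>\<alpha>\<in>Poly_Mapping.keys h. \<phi> (coef h \<alpha>)) = (\<Sum>\<alpha>\<in>D. \<phi> (coef h \<alpha>))"
    if "\<phi> 0 = 0" for \<phi> :: "real \<Rightarrow> real"
    by (rule sum.mono_neutral_left) (use assms that in \<open>auto simp: in_keys_iff\<close>)
  show ?thesis
    unfolding coef_norm_def using sums[of abs] sums[of "\<lambda>t. t\<^sup>2"] by (simp add: Max_set)
qed

text \<open>
  The summand 1 is there for \<open>k = 2\<close>, where \<open>coef_norm\<close> is a sum of squares and only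
  \<open>\<bar>t\<bar> \<le> 1 + t\<^sup>2\<close> is available.
\<close>

lemma abs_coef_le_coef_norm: "\<bar>coef h \<alpha>\<bar> \<le> 1 + coef_norm k h"
proof -
  let ?D = "insert \<alpha> (Poly_Mapping.keys h)"
  have "\<bar>coef h \<alpha>\<bar> \<le> 1 + (coef h \<alpha>)\<^sup>2"
    using zero_le_power2[of "\<bar>coef h \<alpha>\<bar> - 1"] zero_le_power2[of "coef h \<alpha>"]
    by (simp add: power2_eq_square algebra_simps)
  moreover have "(coef h \<alpha>)\<^sup>2 \<le> (\<Sum>\<beta>\<in>?D. (coef h \<beta>)\<^sup>2)" "\<bar>coef h \<alpha>\<bar> \<le> (\<Sum>\<beta>\<in>?D. \<bar>coef h \<beta>\<bar>)"
    by (rule member_le_sum; simp)+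
  moreover have "\<bar>coef h \<alpha>\<bar> \<le> Max (insert 0 ((\<lambda>\<beta>. \<bar>coef h \<beta>\<bar>) ` ?D))"
    by (rule Max_ge) auto
  moreover have "finite ?D" "Poly_Mapping.keys h \<subseteq> ?D"
    by auto
  ultimately show ?thesis
    by (simp only: coef_norm_eq_superset[of ?D h k] split: if_split) linarith
qed

lemma continuous_on_Max_image:
  fixes \<phi> :: "'i \<Rightarrow> 'a::topological_space \<Rightarrow> real"
  assumes "finite D" "\<And>i. i \<in> D \<Longrightarrow> continuous_on S (\<phi> i)"
  shows "continuous_on S (\<lambda>x. Max (insert c ((\<lambda>i. \<phi> i x) ` D)))"
  using assms
proof (induction D)
  case (insert i D)
  have "Max (insert c ((\<lambda>i. \<phi> i x) ` insert i D)) = max (\<phi> i x) (Max (insert c ((\<lambda>i. \<phi> i x) ` D)))" for x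
    using insert.hyps by (simp add: insert_commute[of c])
  then show ?case
    using insert by (simp add: continuous_on_max)
qed simp

lemma continuous_on_coef_norm:
  fixes h :: "'a::topological_space \<Rightarrow> 'n rpoly"
  assumes "finite D" "\<And>x. Poly_Mapping.keys (h x) \<subseteq> D"
    and "\<And>\<alpha>. continuous_on S (\<lambda>x. coef (h x) \<alpha>)"
  shows "continuous_on S (\<lambda>x. coef_norm k (h x))"
proof -
  have "coef_norm k (h x) =
    (if k = 1 then (\<Sum>\<alpha>\<in>D. \<bar>coef (h x) \<alpha>\<bar>)
     else if k = 2 then (\<Sum>\<alpha>\<in>D. (coef (h x) \<alpha>)\<^sup>2)
     else Max (insert 0 ((\<lambda>\<alpha>. \<bar>coef (h x) \<alpha>\<bar>) ` D)))" for x
    using assms by (intro coef_norm_eq_superset)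
  moreover have "continuous_on S (\<lambda>x. Max (insert 0 ((\<lambda>\<alpha>. \<bar>coef (h x) \<alpha>\<bar>) ` D)))"
    by (intro continuous_on_Max_image continuous_on_rabs assms)
  ultimately show ?thesis
    using assms by (cases "k = 1"; cases "k = 2") (auto intro!: continuous_intros)
qed

section \<open>Quadratic polynomials\<close>

definition unit_exp :: "'n \<Rightarrow> 'n \<Rightarrow>\<^sub>0 nat" where
  "unit_exp i = Poly_Mapping.single i 1"

lemma lookup_unit_exp: "Poly_Mapping.lookup (unit_exp i) k = (if k = i then 1 else 0)"
  by (simp add: unit_exp_def lookup_single when_def)

lemma quad_poly_eq_sum_monomials:
  "quad_poly A b c =
     (\<Sum>i\<in>UNIV. \<Sum>j\<in>UNIV. Poly_Mapping.single (unit_exp i + unit_exp j) (A $ i $ j / 2))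
       + (\<Sum>i\<in>UNIV. Poly_Mapping.single (unit_exp i) (b $ i)) + Poly_Mapping.single 0 c"
  by (simp add: quad_poly_def pconst_def pvar_def unit_exp_def sum_distrib_left mult_single)

lemma peval_quad_poly: "peval (quad_poly A b c) x = x \<bullet> (A *v x) / 2 + b \<bullet> x + c"
proof -
  have lin: "(\<Prod>k\<in>UNIV. (x $ k) ^ Poly_Mapping.lookup (unit_exp i) k) = x $ i" for i
  proof -
    have "(\<Prod>k\<in>UNIV. (x $ k) ^ Poly_Mapping.lookup (unit_exp i) k)
        = (\<Prod>k\<in>UNIV. if k = i then x $ k else 1)"
      by (rule prod.cong) (auto simp: lookup_unit_exp)
    then show ?thesis by simp
  qed
  have quad: "(\<Prod>k\<in>UNIV. (x $ k) ^ Poly_Mapping.lookup (unit_exp i + unit_exp j) k) = x $ i * x $ j" for i j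
    using lin[of i] lin[of j] by (simp add: lookup_add power_add prod.distrib)
  show ?thesis
    unfolding quad_poly_eq_sum_monomials peval_add peval_sum peval_single lin quad
    by (simp add: inner_vec_def matrix_vector_mult_def sum_distrib_left sum_divide_distrib mult_ac)
qed

definition quad_exps :: "('n::finite \<Rightarrow>\<^sub>0 nat) set" where
  "quad_exps = {0} \<union> range unit_exp \<union> range (\<lambda>(i, j). unit_exp i + unit_exp j)"

lemma finite_quad_exps: "finite quad_exps"
  by (simp add: quad_exps_def)

lemma keys_quad_poly: "Poly_Mapping.keys (quad_poly A b c) \<subseteq> quad_exps"
proof -
  have coefs: "coef (quad_poly A b c) \<alpha> = 0" if "\<alpha> \<notin> quad_exps" for \<alpha>
  proof -
    have "0 \<noteq> \<alpha>" "unit_exp i \<noteq> \<alpha>" "unit_exp i + unit_exp j \<noteq> \<alpha>" for i j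
      using that by (auto simp: quad_exps_def)
    then show ?thesis
      unfolding quad_poly_eq_sum_monomials
      by (simp add: lookup_add lookup_sum lookup_single when_def)
  qed
  then show ?thesis
    by (auto simp: in_keys_iff)
qed

lemma quad_poly_in_polys_deg_le_2: "quad_poly A b c \<in> polys_deg_le 2"
proof -
  have "(\<Sum>k\<in>UNIV. Poly_Mapping.lookup (unit_exp i) k) = 1" for i :: 'a
    by (simp add: lookup_unit_exp)
  then have "(\<Sum>i\<in>UNIV. Poly_Mapping.lookup \<alpha> i) \<le> 2" if "\<alpha> \<in> quad_exps" for \<alpha> :: "'a \<Rightarrow>\<^sub>0 nat"
    using that by (auto simp: quad_exps_def lookup_add sum.distrib)
  then show ?thesis
    using keys_quad_poly[of A b c] by (auto simp: polys_deg_le_def)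
qed

lemma unit_exp_eq_iff: "unit_exp i = unit_exp j \<longleftrightarrow> i = j"
  by (metis lookup_unit_exp one_neq_zero)

lemma unit_exp_add_neq_unit_exp: "unit_exp i + unit_exp j \<noteq> unit_exp k"
proof
  assume "unit_exp i + unit_exp j = unit_exp k"
  then have "Poly_Mapping.lookup (unit_exp i + unit_exp j) l = Poly_Mapping.lookup (unit_exp k) l" for l
    by (rule arg_cong)
  from this[of i] this[of j] show False
    by (auto simp: lookup_add lookup_unit_exp split: if_splits)
qed

lemma unit_exp_add_eq_twice_iff: "unit_exp a + unit_exp b = unit_exp i + unit_exp i \<longleftrightarrow> a = i \<and> b = i"
proof
  assume "unit_exp a + unit_exp b = unit_exp i + unit_exp i"
  then have "Poly_Mapping.lookup (unit_exp a + unit_exp b) i = Poly_Mapping.lookup (unit_exp i + unit_exp i) i"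
    by (rule arg_cong)
  then show "a = i \<and> b = i"
    by (auto simp: lookup_add lookup_unit_exp split: if_splits)
qed simp

lemma unit_exp_neq_0: "unit_exp i \<noteq> 0"
  by (metis lookup_unit_exp lookup_zero one_neq_zero)

lemma unit_exp_add_neq_0: "unit_exp i + unit_exp j \<noteq> 0"
  by (metis add_is_0 lookup_add lookup_unit_exp lookup_zero one_neq_zero)

lemma coef_quad_poly_linear: "coef (quad_poly A b c) (unit_exp i) = b $ i"
  by (simp add: quad_poly_eq_sum_monomials lookup_add lookup_sum lookup_single when_def
      unit_exp_eq_iff unit_exp_add_neq_unit_exp unit_exp_neq_0[symmetric])

lemma coef_quad_poly_square: "coef (quad_poly A b c) (unit_exp i + unit_exp i) = A $ i $ i / 2"
proof -
  have "coef (quad_poly A b c) (unit_exp i + unit_exp i)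
      = (\<Sum>a\<in>UNIV. \<Sum>b\<in>UNIV. if a = i \<and> b = i then A $ a $ b / 2 else 0)"
    by (simp add: quad_poly_eq_sum_monomials lookup_add[of "_::_ \<Rightarrow>\<^sub>0 real"] lookup_sum lookup_single
        when_def unit_exp_add_eq_twice_iff unit_exp_add_neq_unit_exp[symmetric]
        unit_exp_add_neq_0[symmetric])
  also have "\<dots> = (\<Sum>a\<in>UNIV. if a = i then A $ a $ i / 2 else 0)"
    by (rule sum.cong) auto
  finally show ?thesis by simp
qed

lemma continuous_on_coef_quad_poly:
  "continuous_on S (\<lambda>(A, b). coef (quad_poly A b c) \<alpha>)"
proof -
  have "continuous_on S (\<lambda>z. r z when P)"
    if "continuous_on S r" for P and r :: "(real ^ 'a ^ 'a) \<times> (real ^ 'a) \<Rightarrow> real"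
    using that by (cases P) auto
  then show ?thesis
    unfolding quad_poly_eq_sum_monomials lookup_add lookup_sum lookup_single case_prod_beta
    by (intro continuous_on_add continuous_on_sum) (simp_all add: continuous_intros)
qed

section \<open>Positive semidefinite matrices\<close>

lemma psd_symmetric_inner:
  assumes "psd A"
  shows "y \<bullet> (A *v x) = x \<bullet> (A *v y)"
  using assms by (metis dot_lmul_matrix inner_commute psd_def transpose_matrix_vector)

lemma closed_Collect_psd: "closed {A :: real ^ ('n::finite) ^ 'n. psd A}"
proof -
  have "{A :: real ^ 'n ^ 'n. psd A}
      = {A. transpose A = A} \<inter> (\<Inter>x. {A. 0 \<le> x \<bullet> (A *v x)})"
    by (auto simp: psd_def)
  moreover have "closed {A :: real ^ 'n ^ 'n. transpose A = A}"
    unfolding transpose_def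
    by (intro closed_Collect_eq continuous_intros)
  moreover have "closed {A :: real ^ 'n ^ 'n. 0 \<le> x \<bullet> (A *v x)}" for x
    unfolding matrix_vector_mult_def
    by (intro closed_Collect_le continuous_intros)
  ultimately show ?thesis
    by (simp add: closed_INT closed_Int)
qed

text \<open>Test semidefiniteness on the vectors \<open>e\<^sub>i + e\<^sub>j\<close> and \<open>e\<^sub>i - e\<^sub>j\<close>.\<close>

lemma psd_abs_entry_le_diagonal:
  assumes "psd A"
  shows "\<bar>A $ i $ j\<bar> \<le> (A $ i $ i + A $ j $ j) / 2"
proof -
  let ?e = "\<lambda>i. axis i (1 :: real)"
  have entry: "?e a \<bullet> (A *v ?e b) = A $ a $ b" for a b
    by (simp add: inner_axis' matrix_vector_mul_component inner_axis)
  have sym: "A $ j $ i = A $ i $ j"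
    using psd_symmetric_inner[OF assms, of "?e j" "?e i"] by (simp add: entry)
  have "0 \<le> (?e i + ?e j) \<bullet> (A *v (?e i + ?e j))" "0 \<le> (?e i - ?e j) \<bullet> (A *v (?e i - ?e j))"
    using assms by (auto simp: psd_def)
  then show ?thesis
    by (simp add: entry sym inner_add_left inner_add_right inner_diff_left inner_diff_right
        matrix_vector_right_distrib matrix_vector_mult_diff_distrib)
qed

text \<open>
  The gap between a quadratic form and its chord is \<open>t (1 - t) (x - y) \<bullet> A (x - y)\<close>, where \<open>t\<close> is
  the parameter along the chord.
\<close>

lemma convex_on_quad_poly:
  assumes "psd A"
  shows "convex_on UNIV (peval (quad_poly A b c))"
proof (rule convex_onI)
  fix t :: real and x y :: "real ^ 'a"
  assume t: "0 < t" "t < 1"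
  define Q where "Q u v = u \<bullet> (A *v v)" for u v
  have sym: "Q y x = Q x y"
    unfolding Q_def by (rule psd_symmetric_inner[OF assms])
  have "0 \<le> t * (1 - t) * Q (x - y) (x - y)"
    using assms t by (auto simp: psd_def Q_def)
  moreover have "Q (x - y) (x - y) = Q x x - 2 * Q x y + Q y y"
    using sym by (simp add: Q_def inner_diff_left inner_diff_right matrix_vector_mult_diff_distrib)
  moreover have "Q ((1 - t) *\<^sub>R x + t *\<^sub>R y) ((1 - t) *\<^sub>R x + t *\<^sub>R y)
      = (1 - t)\<^sup>2 * Q x x + 2 * t * (1 - t) * Q x y + t\<^sup>2 * Q y y"
    using sym
    by (simp add: Q_def inner_add_left inner_add_right matrix_vector_right_distrib
        matrix_vector_mult_scaleR power2_eq_square algebra_simps)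
  ultimately have chord: "Q ((1 - t) *\<^sub>R x + t *\<^sub>R y) ((1 - t) *\<^sub>R x + t *\<^sub>R y) \<le> (1 - t) * Q x x + t * Q y y"
    by (simp add: power2_eq_square algebra_simps)
  have "peval (quad_poly A b c) z = Q z z / 2 + b \<bullet> z + c" for z
    by (simp add: peval_quad_poly Q_def)
  moreover have "b \<bullet> ((1 - t) *\<^sub>R x + t *\<^sub>R y) = (1 - t) * (b \<bullet> x) + t * (b \<bullet> y)"
    by (simp only: inner_add_right inner_scaleR_right)
  ultimately show "peval (quad_poly A b c) ((1 - t) *\<^sub>R x + t *\<^sub>R y)
      \<le> (1 - t) * peval (quad_poly A b c) x + t * peval (quad_poly A b c) y"
    using chord by (simp only:) (simp add: field_simps)
qed simp

section \<open>Concave constraints and their gradients\<close>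

lemma gradient_works:
  fixes F :: "'a::euclidean_space \<Rightarrow> real"
  assumes "F differentiable (at x)"
  shows "GDERIV F x :> gradient F x"
proof -
  obtain F' where F': "(F has_derivative F') (at x)"
    using assms by (auto simp: differentiable_def)
  then interpret F': bounded_linear F'
    by (rule has_derivative_bounded_linear)
  \<comment> \<open>A linear functional is the inner product with its values on the standard basis.\<close>
  define D where "D = (\<Sum>b\<in>Basis. F' b *\<^sub>R b)"
  have "F' h = h \<bullet> D" for h
  proof -
    have "F' h = F' (\<Sum>b\<in>Basis. (h \<bullet> b) *\<^sub>R b)"
      by (simp add: euclidean_representation)
    also have "\<dots> = h \<bullet> D"
      by (simp add: F'.sum F'.scaleR D_def inner_sum_right mult.commute)
    finally show ?thesis .
  qed
  then have D: "GDERIV F x :> D"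
    using F' by (simp add: gderiv_def flip: fun_eq_iff) (metis (no_types, lifting) ext)
  moreover have "D' = D" if "GDERIV F x :> D'" for D'
  proof -
    have "(\<lambda>h. h \<bullet> D') = (\<lambda>h. h \<bullet> D)"
      using that D unfolding gderiv_def by (rule has_derivative_unique)
    then show ?thesis
      by (metis inner_commute vector_eq_rdot)
  qed
  ultimately show ?thesis
    unfolding gradient_def by (rule theI)
qed

text \<open>Restricting to the line through \<open>x\<close> and \<open>y\<close> reduces this to the one-dimensional tangent bound.\<close>

lemma concave_on_le_tangent:
  fixes F :: "'a::euclidean_space \<Rightarrow> real"
  assumes conc: "concave_on UNIV F" and diff: "F differentiable (at x)"
  shows "F y \<le> F x + gradient F x \<bullet> (y - x)"
proof -
  define \<phi> where "\<phi> t = - F (x + t *\<^sub>R (y - x))" for t :: real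
  have "convex_on UNIV \<phi>"
  proof (rule convex_onI)
    fix t a b :: real
    assume t: "0 < t" "t < 1"
    have "x + ((1 - t) * a + t * b) *\<^sub>R (y - x)
        = (1 - t) *\<^sub>R (x + a *\<^sub>R (y - x)) + t *\<^sub>R (x + b *\<^sub>R (y - x))"
      by (simp add: algebra_simps)
    then show "\<phi> ((1 - t) *\<^sub>R a + t *\<^sub>R b) \<le> (1 - t) * \<phi> a + t * \<phi> b"
      using conc t convex_onD[of UNIV "\<lambda>x. - F x" t]
      by (simp add: \<phi>_def concave_on_def)
  qed simp
  moreover have "(\<phi> has_real_derivative - (gradient F x \<bullet> (y - x))) (at 0)"
  proof -
    have "(F has_derivative (\<lambda>h. h \<bullet> gradient F x)) (at (x + 0 *\<^sub>R (y - x)))"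
      using gradient_works[OF diff] by (simp add: gderiv_def)
    moreover have "((\<lambda>t. x + t *\<^sub>R (y - x)) has_derivative (\<lambda>t. t *\<^sub>R (y - x))) (at 0)"
      by (auto intro!: derivative_eq_intros)
    ultimately have "((\<lambda>t. F (x + t *\<^sub>R (y - x))) has_derivative (\<lambda>t. (t *\<^sub>R (y - x)) \<bullet> gradient F x)) (at 0)"
      by (rule has_derivative_compose[rotated])
    then have "((\<lambda>t. F (x + t *\<^sub>R (y - x))) has_real_derivative (gradient F x \<bullet> (y - x))) (at 0)"
      by (simp add: has_field_derivative_def inner_commute mult_commute_abs)
    then show ?thesis
      unfolding \<phi>_def by (rule DERIV_minus)
  qed
  ultimately have "- (gradient F x \<bullet> (y - x)) * (1 - 0) \<le> \<phi> 1 - \<phi> 0"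
    by (intro convex_on_imp_above_tangent[of UNIV]) auto
  then show ?thesis
    by (simp add: \<phi>_def)
qed

lemma convex_feasible_region:
  assumes "\<And>j. j \<in> {1..m} \<Longrightarrow> concave_on UNIV (peval (g j))"
  shows "convex (feasible_region g m)"
proof -
  have "convex {x. 0 \<le> peval (g j) x}" if "j \<in> {1..m}" for j
  proof (rule convexI)
    fix x y and u v :: real
    assume *: "x \<in> {x. 0 \<le> peval (g j) x}" "y \<in> {x. 0 \<le> peval (g j) x}" "0 \<le> u" "0 \<le> v" "u + v = 1"
    then have "0 \<le> u * peval (g j) x + v * peval (g j) y"
      by simp
    also have "\<dots> \<le> peval (g j) (u *\<^sub>R x + v *\<^sub>R y)"
      using assms[OF that] * by (simp add: concave_on_iff)
    finally show "u *\<^sub>R x + v *\<^sub>R y \<in> {x. 0 \<le> peval (g j) x}"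
      by simp
  qed
  moreover have "feasible_region g m = (\<Inter>j\<in>{1..m}. {x. 0 \<le> peval (g j) x})"
    by (auto simp: feasible_region_def)
  ultimately show ?thesis
    by (simp only: convex_INT)
qed

section \<open>Sufficiency of the KKT conditions\<close>

text \<open>
  The gradients of the active constraints have nonnegative inner product with every feasible
  point, so both the linear and the quadratic part of \<open>quad_poly A b c\<close> are nonnegative there and
  vanish at \<open>0\<close>.
\<close>

lemma inv_feasible_imp_zero_arg_min:
  assumes concave: "\<And>j. j \<in> {1..m} \<Longrightarrow> concave_on UNIV (peval (g j))"
    and zero: "0 \<in> feasible_region g m"
    and feas: "inv_feasible g m (A, b, lam)"
  shows "is_arg_min (peval (quad_poly A b c)) (\<lambda>x. x \<in> feasible_region g m) 0"
proof -
  let ?J = "active_set g m 0"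
  have "peval (quad_poly A b c) 0 \<le> peval (quad_poly A b c) x" if x: "x \<in> feasible_region g m" for x
  proof -
    have "0 \<le> gradient (peval (g j)) 0 \<bullet> x" if "j \<in> ?J" for j
    proof -
      have j: "j \<in> {1..m}" "peval (g j) 0 = 0"
        using that by (auto simp: active_set_def)
      have "0 \<le> peval (g j) x"
        using x j by (auto simp: feasible_region_def)
      also have "\<dots> \<le> gradient (peval (g j)) 0 \<bullet> x"
        using concave_on_le_tangent[OF concave[OF j(1)] differentiable_peval, of x 0] j(2) by simp
      finally show ?thesis .
    qed
    then have "0 \<le> b \<bullet> x"
      using feas by (auto simp: inv_feasible_def inner_sum_left intro!: sum_nonneg)
    moreover have "0 \<le> x \<bullet> (A *v x)"
      using feas by (auto simp: inv_feasible_def psd_def)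
    ultimately show ?thesis
      by (simp add: peval_quad_poly)
  qed
  with zero show ?thesis
    by (auto simp: is_arg_min_def not_less)
qed

section \<open>Existence of a minimizer\<close>

text \<open>
  This identifies the vectors \<open>b\<close> that admit multipliers with a finitely generated cone, which is
  known to be closed. The family \<open>v\<close> is indexed because different constraints may have the same
  gradient.
\<close>

lemma convex_cone_hull_image_eq:
  assumes "finite J"
  shows "convex_cone hull (v ` J) = {\<Sum>j\<in>J. c j *\<^sub>R v j | c. \<forall>j\<in>J. 0 \<le> c j}" (is "_ = ?R")
proof
  show "convex_cone hull (v ` J) \<subseteq> ?R"
  proof (rule hull_minimal)
    show "v ` J \<subseteq> ?R"
    proof
      fix w assume "w \<in> v ` J"
      then obtain i where i: "i \<in> J" "w = v i"
        by auto
      then have "w = (\<Sum>j\<in>J. (if j = i then 1 else 0) *\<^sub>R v j)"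
        using assms by (simp add: if_distrib[of "\<lambda>r. r *\<^sub>R _"] cong: if_cong)
      then show "w \<in> ?R"
        by fastforce
    qed
    have "0 \<in> ?R"
      by (force intro: exI[of _ "\<lambda>_. 0"])
    moreover have "x + y \<in> ?R" if x: "x \<in> ?R" and y: "y \<in> ?R" for x y
    proof -
      obtain c where "x = (\<Sum>j\<in>J. c j *\<^sub>R v j)" "\<forall>j\<in>J. 0 \<le> c j"
        using x by blast
      moreover obtain d where "y = (\<Sum>j\<in>J. d j *\<^sub>R v j)" "\<forall>j\<in>J. 0 \<le> d j"
        using y by blast
      ultimately have "x + y = (\<Sum>j\<in>J. (c j + d j) *\<^sub>R v j)" "\<forall>j\<in>J. 0 \<le> c j + d j"
        by (auto simp: scaleR_add_left sum.distrib)
      then show ?thesis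
        by (intro CollectI exI[of _ "\<lambda>j. c j + d j"] conjI)
    qed
    moreover have "a *\<^sub>R x \<in> ?R" if x: "x \<in> ?R" and a: "0 \<le> a" for x and a :: real
    proof -
      obtain c where "x = (\<Sum>j\<in>J. c j *\<^sub>R v j)" "\<forall>j\<in>J. 0 \<le> c j"
        using x by blast
      then have "a *\<^sub>R x = (\<Sum>j\<in>J. (a * c j) *\<^sub>R v j)" "\<forall>j\<in>J. 0 \<le> a * c j"
        using a by (auto simp: scaleR_sum_right)
      then show ?thesis
        by (intro CollectI exI[of _ "\<lambda>j. a * c j"] conjI)
    qed
    ultimately show "convex_cone ?R"
      unfolding convex_cone_iff by (intro conjI ballI allI impI)
  qed
  show "?R \<subseteq> convex_cone hull (v ` J)"
  proof clarify
    fix c :: "'a \<Rightarrow> real"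
    assume c: "\<forall>j\<in>J. 0 \<le> c j"
    have "(\<Sum>j\<in>I. c j *\<^sub>R v j) \<in> convex_cone hull (v ` J)" if "finite I" "I \<subseteq> J" for I
      using that c
      by (induction I)
        (auto intro: convex_cone_hull_contains_0 convex_cone_hull_add convex_cone_hull_mul hull_inc)
    then show "(\<Sum>j\<in>J. c j *\<^sub>R v j) \<in> convex_cone hull (v ` J)"
      using assms by blast
  qed
qed

lemma continuous_coercive_attains_inf:
  fixes F :: "'a::heine_borel \<Rightarrow> real"
  assumes "closed S" "S \<noteq> {}" "continuous_on S F"
    and coercive: "\<And>M. bounded {z \<in> S. F z \<le> M}"
  shows "\<exists>z\<in>S. \<forall>w\<in>S. F z \<le> F w"
proof -
  obtain z0 where z0: "z0 \<in> S"
    using assms by auto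
  let ?L = "{z \<in> S. F z \<le> F z0}"
  have "?L = S \<inter> F -` {..F z0}"
    by auto
  then have "compact ?L"
    using assms(1,3) coercive[of "F z0"]
    by (simp add: compact_eq_bounded_closed continuous_closed_preimage)
  then obtain z where "z \<in> ?L" "\<forall>w\<in>?L. F z \<le> F w"
    using continuous_attains_inf[of ?L F] z0 assms(3) by (auto intro: continuous_on_subset)
  then show ?thesis
    by (metis (mono_tags, lifting) linorder_le_cases mem_Collect_eq order_trans)
qed

text \<open>
  The norm bounds the linear and pure square coefficients, hence \<open>b\<close> and the diagonal of \<open>A\<close>;
  semidefiniteness then bounds the remaining entries of \<open>A\<close>.
\<close>

lemma bounded_coef_norm_sublevel:
  fixes f :: "('n::finite) rpoly"
  shows "bounded {(A, b). psd A \<and> coef_norm k (f - quad_poly A b c) \<le> M}"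
proof -
  define B where "B = (\<Sum>\<alpha>\<in>Poly_Mapping.keys f. \<bar>coef f \<alpha>\<bar>) + 1 + M"
  have norm_le: "norm A \<le> (\<Sum>i\<in>(UNIV::'n set). \<Sum>j\<in>(UNIV::'n set). 2 * B)" "norm b \<le> (\<Sum>i\<in>(UNIV::'n set). B)"
    if A: "psd A" and M: "coef_norm k (f - quad_poly A b c) \<le> M" for A and b :: "real ^ 'n"
  proof -
    have coef_le: "\<bar>coef (quad_poly A b c) \<alpha>\<bar> \<le> B" for \<alpha>
    proof -
      have "\<bar>coef f \<alpha>\<bar> \<le> (\<Sum>\<alpha>\<in>Poly_Mapping.keys f. \<bar>coef f \<alpha>\<bar>)"
        by (cases "\<alpha> \<in> Poly_Mapping.keys f") (auto intro: member_le_sum simp: in_keys_iff sum_nonneg)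
      then show ?thesis
        using abs_coef_le_coef_norm[of "f - quad_poly A b c" \<alpha> k] M
        by (simp add: lookup_minus B_def)
    qed
    show "norm b \<le> (\<Sum>i\<in>(UNIV::'n set). B)"
      using coef_le[of "unit_exp _"] unfolding coef_quad_poly_linear
      by (intro order_trans[OF norm_le_l1_cart] sum_mono)
    have "A $ i $ i \<le> 2 * B" for i
      using coef_le[of "unit_exp i + unit_exp i"] unfolding coef_quad_poly_square by linarith
    then have "\<bar>A $ i $ j\<bar> \<le> (2 * B + 2 * B) / 2" for i j
      by (intro order_trans[OF psd_abs_entry_le_diagonal[OF A]] divide_right_mono add_mono) simp_all
    then have "\<bar>A $ i $ j\<bar> \<le> 2 * B" for i j
      by simp
    then have "norm (A $ i) \<le> (\<Sum>j\<in>(UNIV::'n set). 2 * B)" for i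
      by (intro order_trans[OF norm_le_l1_cart] sum_mono)
    then have "(\<Sum>i\<in>UNIV. norm (A $ i)) \<le> (\<Sum>i\<in>(UNIV::'n set). \<Sum>j\<in>(UNIV::'n set). 2 * B)"
      by (intro sum_mono)
    moreover have "norm A \<le> (\<Sum>i\<in>UNIV. norm (A $ i))"
      unfolding norm_vec_def[of A] by (rule L2_set_le_sum) simp
    ultimately show "norm A \<le> (\<Sum>i\<in>(UNIV::'n set). \<Sum>j\<in>(UNIV::'n set). 2 * B)"
      by linarith
  qed
  have "{(A, b). psd A \<and> coef_norm k (f - quad_poly A b c) \<le> M}
      \<subseteq> cball 0 (\<Sum>i\<in>(UNIV::'n set). \<Sum>j\<in>(UNIV::'n set). 2 * B) \<times> cball 0 (\<Sum>i\<in>(UNIV::'n set). B)"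
    using norm_le by auto
  then show ?thesis
    by (rule bounded_subset[rotated]) (intro bounded_Times bounded_cball)
qed

lemma inv_optimal_exists:
  fixes g :: "nat \<Rightarrow> ('n::finite) rpoly"
  shows "\<exists>q. inv_optimal g m f k q"
proof -
  let ?J = "active_set g m 0" and ?v = "\<lambda>j. gradient (peval (g j)) 0"
  define S where "S = {A :: real ^ 'n ^ 'n. psd A} \<times> (convex_cone hull (?v ` ?J))"
  define F where "F = (\<lambda>(A, b). coef_norm k (f - quad_poly A b (peval f 0)))"
  have J: "finite ?J"
    by (simp add: active_set_def)
  have "closed S"
    unfolding S_def by (intro closed_Times closed_Collect_psd closed_convex_cone_hull finite_imageI J)
  moreover have "(0, 0) \<in> S"
    by (simp add: S_def convex_cone_hull_contains_0 psd_def transpose_def vec_eq_iff)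
  moreover have "continuous_on S F"
    unfolding F_def case_prod_beta
  proof (rule continuous_on_coef_norm)
    show "finite (Poly_Mapping.keys f \<union> quad_exps)"
      by (simp add: finite_quad_exps)
    show "Poly_Mapping.keys (f - quad_poly (fst z) (snd z) (peval f 0)) \<subseteq> Poly_Mapping.keys f \<union> quad_exps" for z
      by (rule order_trans[OF keys_diff]) (intro Un_mono order_refl keys_quad_poly)
    show "continuous_on S (\<lambda>z. coef (f - quad_poly (fst z) (snd z) (peval f 0)) \<alpha>)" for \<alpha>
      unfolding lookup_minus
      by (intro continuous_intros continuous_on_coef_quad_poly[unfolded case_prod_beta])
  qed
  moreover have "bounded {z \<in> S. F z \<le> M}" for M
    by (rule bounded_subset[OF bounded_coef_norm_sublevel[of k f "peval f 0" M]])
      (auto simp: S_def F_def)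
  ultimately have "\<exists>z\<in>S. \<forall>w\<in>S. F z \<le> F w"
    by (intro continuous_coercive_attains_inf) auto
  then obtain A b where S: "(A, b) \<in> S" and min: "\<And>w. w \<in> S \<Longrightarrow> F (A, b) \<le> F w"
    by (metis surj_pair)
  have feas_iff: "(A, b) \<in> S \<longleftrightarrow> (\<exists>lam. inv_feasible g m (A, b, lam))" for A b
    unfolding S_def convex_cone_hull_image_eq[OF J] inv_feasible_def by auto
  obtain lam where "inv_feasible g m (A, b, lam)"
    using S feas_iff by blast
  moreover have "inv_objective f k (A, b, lam) \<le> inv_objective f k (A', b', lam')"
    if "inv_feasible g m (A', b', lam')" for A' b' lam'
  proof -
    have "(A', b') \<in> S"
      using that feas_iff by blast
    from min[OF this] show ?thesis
      by (simp add: F_def inv_objective_def)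
  qed
  ultimately have "is_arg_min (inv_objective f k) (inv_feasible g m) (A, b, lam)"
    by (auto simp: is_arg_min_def not_less)
  then show ?thesis
    unfolding inv_optimal_def by blast
qed

theorem lemma3p8:
  fixes g :: "nat \<Rightarrow> ('n::finite) rpoly" and m :: nat and f :: "'n rpoly" and k :: enat
  assumes concave: "\<And>j. j \<in> {1..m} \<Longrightarrow> concave_on UNIV (peval (g j))"
    and zero_feasible: "0 \<in> feasible_region g m"
    and k: "k \<in> {1, 2, \<infinity>}"
  shows "(\<exists>q. inv_optimal g m f k q) \<and>
    (\<forall>q. inv_optimal g m f k q \<longrightarrow>
       q \<in> polys_deg_le 2 \<and>
       convex (feasible_region g m) \<and> convex_on UNIV (peval q) \<and>
       is_arg_min (peval q) (\<lambda>x. x \<in> feasible_region g m) 0)"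
proof (intro conjI allI impI)
  show "\<exists>q. inv_optimal g m f k q"
    by (rule inv_optimal_exists)
  show "convex (feasible_region g m)"
    using concave by (rule convex_feasible_region)
  fix q
  assume "inv_optimal g m f k q"
  then obtain A b lam where feas: "inv_feasible g m (A, b, lam)"
    and q: "q = quad_poly A b (peval f 0)"
    by (auto simp: inv_optimal_def is_arg_min_def)
  show "q \<in> polys_deg_le 2"
    unfolding q by (rule quad_poly_in_polys_deg_le_2)
  show "convex_on UNIV (peval q)"
    unfolding q using feas by (intro convex_on_quad_poly) (simp add: inv_feasible_def)
  show "is_arg_min (peval q) (\<lambda>x. x \<in> feasible_region g m) 0"
    unfolding q using concave zero_feasible feas by (rule inv_feasible_imp_zero_arg_min)
qed

end
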